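(* (1) Let $X$ be a Banach space and $T\in L(X)$. The following statements are equivalent: (i) $T$ is an EP operator; (ii) there exists $P\in\mathcal{E}(X)$ such that $N(P)=N(T)$ and $R(P)=R(T)$. (2) Let $A$ be a unital Banach algebra and let $a\in A$ be a regular element such that $a^{\dagger}$ exists. The following statements are equivalent: (i) $a$ is EP; (ii) there exists $P\in\mathcal{E}(A)$ such that $N(P)=a^{-1}(0)$ and $R(P)=aA$; (iii) there exists $P\in\mathcal{E}(A)$ such that $N(P)=a_{-1}(0)$ and $R(P)=Aa$. Furthermore, in each case, if such $P$ exists, then it is unique.
   Context: Scalars are complex. A unital Banach algebra $A$ has a unit $e$ with $\|e\|=1$. For a Banach space $X$, $L(X)$ is the Banach algebra of bounded linear operators on $X$ with the operator norm; $N(T)$ and $R(T)$ are the null space and range of $T$. For $a\in A$: $a^{-1}(0)=\{x\in A: ax=0\}$, $a_{-1}(0)=\{x\in A: xa=0\}$, $aA=\{ax:x\in A\}$, $Aa=\{xa:x\in A\}$. An element $a$ is regular if $a=aba$ for some $b\in A$. An element $h$ of a unital Banach algebra is hermitian if $\|\exp(ith)\|=1$ for all $t\in\mathbb{R}$. $\mathcal{E}(X)=\{P\in L(X): P^2=P,\ P\text{ is hermitian in }L(X)\}$, and $\mathcal{E}(A)\subseteq L(A)$ is this set for the Banach space $A$. The Moore-Penrose inverse of $a\in A$, denoted $a^{\dagger}$, is the (at most one) $x\in A$ with $a=axa$, $x=xax$, and $ax$ and $xa$ hermitian. An element $a\in A$ is EP if $a^{\dagger}$ exists and $aa^{\dagger}=a^{\dagger}a$.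 For operators $T\in L(X)$ these notions are taken in the algebra $L(X)$. *)

theory Defs
  imports "HOL-Analysis.Analysis"
begin

section \<open>Complex Banach spaces and algebras\<close>

text \<open>
  The real structure is kept as a superclass, so that norms, limits, series and
  completeness are those of the library; the complex scalar multiplication extends the real one.
\<close>

class scaleC =
  fixes scaleC :: "complex \<Rightarrow> 'a \<Rightarrow> 'a"  (infixr \<open>*\<^sub>C\<close> 75)

class complex_vector = real_vector + scaleC +
  assumes scaleC_add_right: "c *\<^sub>C (x + y) = c *\<^sub>C x + c *\<^sub>C y"
    and scaleC_add_left: "(c + d) *\<^sub>C x = c *\<^sub>C x + d *\<^sub>C x"
    and scaleC_scaleC: "c *\<^sub>C d *\<^sub>C x = (c * d) *\<^sub>C x"
    and scaleC_of_real: "complex_of_real r *\<^sub>C x = r *\<^sub>R x"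

class complex_normed_vector = complex_vector + real_normed_vector +
  assumes norm_scaleC: "norm (c *\<^sub>C x) = cmod c * norm x"

class complex_banach = complex_normed_vector + banach

text \<open>
  The next class does not impose \<open>norm 1 = 1\<close>, nor even \<open>0 \<noteq> 1\<close>: this way the bounded operators
  on the zero space are an instance as well.
\<close>

class complex_banach_monoid_algebra = complex_banach + real_normed_algebra + monoid_mult +
  assumes mult_scaleC_left: "(c *\<^sub>C x) * y = c *\<^sub>C (x * y)"
    and mult_scaleC_right: "x * (c *\<^sub>C y) = c *\<^sub>C (x * y)"

text \<open>Unital Banach algebras, with \<open>norm 1 = 1\<close> coming from \<^class>\<open>real_normed_algebra_1\<close>.\<close>

class complex_banach_algebra_1 = complex_banach_monoid_algebra + real_normed_algebra_1

instantiation complex :: complex_banach_algebra_1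
begin

definition scaleC_complex :: "complex \<Rightarrow> complex \<Rightarrow> complex"
  where "scaleC_complex c x = c * x"

instance
  by standard (auto simp: scaleC_complex_def algebra_simps scaleR_conv_of_real norm_mult)

end


section \<open>The algebra of bounded complex linear operators\<close>

typedef (overloaded) 'a bop =
  "{T :: 'a::complex_normed_vector \<Rightarrow>\<^sub>L 'a.
      \<forall>c x. blinfun_apply T (c *\<^sub>C x) = c *\<^sub>C blinfun_apply T x}"
  morphisms blinfun_of_bop bop_of_blinfun
  by (rule exI[of _ id_blinfun]) simp

setup_lifting type_definition_bop

lift_definition bop_apply :: "'a::complex_normed_vector bop \<Rightarrow> 'a \<Rightarrow> 'a" is blinfun_apply .

lemma scaleC_zero_right: "c *\<^sub>C (0::'a::complex_vector) = 0"
  using scaleC_add_right[of c 0 "0::'a"] by simp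

lemma scaleC_minus_right: "c *\<^sub>C (- x :: 'a::complex_vector) = - (c *\<^sub>C x)"
  using scaleC_add_right[of c x "- x"] by (simp add: scaleC_zero_right eq_neg_iff_add_eq_0 add.commute)

lemma scaleC_diff_right: "c *\<^sub>C (x - y :: 'a::complex_vector) = c *\<^sub>C x - c *\<^sub>C y"
  using scaleC_add_right[of c x "- y"] by (simp add: scaleC_minus_right)

lemma scaleC_scaleR: "c *\<^sub>C r *\<^sub>R (x :: 'a::complex_vector) = r *\<^sub>R c *\<^sub>C x"
  by (simp add: scaleC_of_real[symmetric] scaleC_scaleC mult.commute)

lemma bounded_linear_scaleC: "bounded_linear (\<lambda>x :: 'a::complex_normed_vector. c *\<^sub>C x)"
  by (rule bounded_linear_intro[where K = "cmod c"])
    (auto simp: scaleC_add_right scaleC_scaleR norm_scaleC mult.commute)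

text \<open>All operations are pointwise, multiplication is composition and the norm is the operator norm.\<close>

instantiation bop :: (complex_normed_vector) "{complex_normed_vector, real_normed_algebra, monoid_mult}"
begin

lift_definition zero_bop :: "'a bop" is 0 by (simp add: scaleC_zero_right)
lift_definition one_bop :: "'a bop" is id_blinfun by simp
lift_definition plus_bop :: "'a bop \<Rightarrow> 'a bop \<Rightarrow> 'a bop" is "(+)"
  by (simp add: blinfun.add_left scaleC_add_right)
lift_definition minus_bop :: "'a bop \<Rightarrow> 'a bop \<Rightarrow> 'a bop" is "(-)"
  by (simp add: blinfun.diff_left scaleC_diff_right)
lift_definition uminus_bop :: "'a bop \<Rightarrow> 'a bop" is uminus
  by (simp add: blinfun.minus_left scaleC_minus_right)
lift_definition times_bop :: "'a bop \<Rightarrow> 'a bop \<Rightarrow> 'a bop" is "(o\<^sub>L)" by simp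
lift_definition scaleR_bop :: "real \<Rightarrow> 'a bop \<Rightarrow> 'a bop" is scaleR
  by (simp add: blinfun.scaleR_left scaleC_scaleR)
lift_definition scaleC_bop :: "complex \<Rightarrow> 'a bop \<Rightarrow> 'a bop"
  is "\<lambda>c T. Blinfun (\<lambda>x. c *\<^sub>C blinfun_apply T x)"
  by (simp add: bounded_linear_Blinfun_apply bounded_linear_compose[OF bounded_linear_scaleC]
      blinfun.bounded_linear_right scaleC_scaleC mult.commute)
lift_definition norm_bop :: "'a bop \<Rightarrow> real" is norm .
definition sgn_bop :: "'a bop \<Rightarrow> 'a bop" where "sgn_bop T = inverse (norm T) *\<^sub>R T"
definition dist_bop :: "'a bop \<Rightarrow> 'a bop \<Rightarrow> real" where "dist_bop S T = norm (S - T)"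
definition uniformity_bop :: "('a bop \<times> 'a bop) filter"
  where "uniformity_bop = (INF e\<in>{0<..}. principal {(S, T). dist S T < e})"
definition open_bop :: "'a bop set \<Rightarrow> bool"
  where "open_bop U \<longleftrightarrow> (\<forall>S\<in>U. eventually (\<lambda>(S', T). S' = S \<longrightarrow> T \<in> U) uniformity)"

lemma bop_apply_simps:
  "bop_apply 0 x = 0" "bop_apply 1 x = x"
  "bop_apply (S + T) x = bop_apply S x + bop_apply T x"
  "bop_apply (S - T) x = bop_apply S x - bop_apply T x"
  "bop_apply (- T) x = - bop_apply T x"
  "bop_apply (S * T) x = bop_apply S (bop_apply T x)"
  "bop_apply (r *\<^sub>R T) x = r *\<^sub>R bop_apply T x"
  "bop_apply (c *\<^sub>C T) x = c *\<^sub>C bop_apply T x"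
  by (transfer; simp add: blinfun.bilinear_simps bounded_linear_Blinfun_apply
      bounded_linear_compose[OF bounded_linear_scaleC] blinfun.bounded_linear_right)+

lemma bop_eqI: "(\<And>x. bop_apply S x = bop_apply T x) \<Longrightarrow> S = T"
  by transfer (rule blinfun_eqI)

lemma bop_apply_linear:
  "bop_apply T 0 = 0"
  "bop_apply T (x + y) = bop_apply T x + bop_apply T y"
  "bop_apply T (x - y) = bop_apply T x - bop_apply T y"
  "bop_apply T (r *\<^sub>R x) = r *\<^sub>R bop_apply T x"
  "bop_apply T (c *\<^sub>C x) = c *\<^sub>C bop_apply T x"
  by (transfer; simp add: blinfun.bilinear_simps)+

lemma norm_bop_onorm: "norm T = onorm (bop_apply T)"
  by transfer (simp add: norm_blinfun.rep_eq)

instance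
proof
  show "norm (c *\<^sub>C T) = cmod c * norm T" for c and T :: "'a bop"
  proof -
    have "onorm (\<lambda>x. c *\<^sub>C bop_apply T x) = onorm (\<lambda>x. cmod c *\<^sub>R bop_apply T x)"
      by (simp add: onorm_def norm_scaleC)
    also have "\<dots> = cmod c * onorm (bop_apply T)"
    proof -
      have "bounded_linear (bop_apply T)" by transfer (rule blinfun.bounded_linear_right)
      then show ?thesis by (simp add: onorm_scaleR)
    qed
    finally show ?thesis
      by (simp add: norm_bop_onorm bop_apply_simps[abs_def])
  qed
  show "dist S T = norm (S - T)" for S T :: "'a bop" by (fact dist_bop_def)
  show "sgn T = inverse (norm T) *\<^sub>R T" for T :: "'a bop" by (fact sgn_bop_def)
  show "uniformity = (INF e\<in>{0<..}. principal {(S :: 'a bop, T). dist S T < e})"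
    by (fact uniformity_bop_def)
  show "open U \<longleftrightarrow> (\<forall>S\<in>U. eventually (\<lambda>(S', T). S' = S \<longrightarrow> T \<in> U) uniformity)"
    for U :: "'a bop set" by (fact open_bop_def)
  show "norm T = 0 \<longleftrightarrow> T = 0" for T :: "'a bop" by transfer simp
  show "norm (S + T) \<le> norm S + norm T" for S T :: "'a bop"
    by transfer (rule norm_triangle_ineq)
  show "norm (r *\<^sub>R T) = \<bar>r\<bar> * norm T" for r and T :: "'a bop" by transfer simp
  show "norm (S * T) \<le> norm S * norm T" for S T :: "'a bop"
    by transfer (rule norm_blinfun_compose)
qed (auto intro!: bop_eqI simp: bop_apply_simps bop_apply_linear algebra_simps
    scaleC_add_right scaleC_add_left scaleC_scaleC scaleC_of_real)

end

instance bop :: (complex_banach) complex_banach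
proof
  fix F :: "nat \<Rightarrow> 'a bop"
  assume "Cauchy F"
  then have "Cauchy (\<lambda>n. blinfun_of_bop (F n))"
    by (simp add: Cauchy_def dist_norm norm_bop.rep_eq minus_bop.rep_eq)
  then obtain L where L: "(\<lambda>n. blinfun_of_bop (F n)) \<longlonglongrightarrow> L"
    using Cauchy_convergent convergent_def by blast
  have lim: "(\<lambda>n. blinfun_apply (blinfun_of_bop (F n)) x) \<longlonglongrightarrow> blinfun_apply L x" for x
    by (intro blinfun.tendsto L tendsto_const)
  have "blinfun_apply L (c *\<^sub>C x) = c *\<^sub>C blinfun_apply L x" for c x
  proof (rule LIMSEQ_unique[OF lim])
    have "blinfun_apply (blinfun_of_bop (F n)) (c *\<^sub>C x) =
        c *\<^sub>C blinfun_apply (blinfun_of_bop (F n)) x" for n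
      using blinfun_of_bop[of "F n"] by simp
    then show "(\<lambda>n. blinfun_apply (blinfun_of_bop (F n)) (c *\<^sub>C x)) \<longlonglongrightarrow> c *\<^sub>C blinfun_apply L x"
      by (simp add: bounded_linear.tendsto[OF bounded_linear_scaleC lim])
  qed
  then have "blinfun_of_bop (bop_of_blinfun L) = L"
    by (intro bop_of_blinfun_inverse) simp
  with L have "F \<longlonglongrightarrow> bop_of_blinfun L"
    by (simp add: LIMSEQ_def dist_norm norm_bop.rep_eq minus_bop.rep_eq)
  then show "convergent F" by (rule convergentI)
qed

instance bop :: (complex_banach) complex_banach_monoid_algebra
  by standard (auto intro!: bop_eqI simp: bop_apply_simps bop_apply_linear)

definition null_space :: "'a::complex_normed_vector bop \<Rightarrow> 'a set"
  where "null_space T = {x. bop_apply T x = 0}"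

definition op_range :: "'a::complex_normed_vector bop \<Rightarrow> 'a set"
  where "op_range T = range (bop_apply T)"


section \<open>Hermitian elements, Moore--Penrose inverses and EP elements\<close>

text \<open>
  The library function \<^const>\<open>exp\<close> requires \<open>norm 1 = 1\<close>; the same power series is used here
  without that requirement.
\<close>

definition alg_exp :: "'a::complex_banach_monoid_algebra \<Rightarrow> 'a"
  where "alg_exp x = (\<Sum>n. x ^ n /\<^sub>R fact n)"

lemma alg_exp_eq_exp: "alg_exp (x :: 'a::complex_banach_algebra_1) = exp x"
  by (simp add: alg_exp_def exp_def)

definition hermitian :: "'a::complex_banach_monoid_algebra \<Rightarrow> bool"
  where "hermitian h \<longleftrightarrow> (\<forall>t::real. norm (alg_exp ((\<i> * complex_of_real t) *\<^sub>C h)) = 1)"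

definition hermitian_projections :: "'a::complex_banach bop set"
  where "hermitian_projections = {P. P * P = P \<and> hermitian P}"

definition regular :: "'a::complex_banach_monoid_algebra \<Rightarrow> bool"
  where "regular a \<longleftrightarrow> (\<exists>b. a = a * b * a)"

definition is_MP_inverse :: "'a::complex_banach_monoid_algebra \<Rightarrow> 'a \<Rightarrow> bool"
  where "is_MP_inverse a x \<longleftrightarrow>
    a = a * x * a \<and> x = x * a * x \<and> hermitian (a * x) \<and> hermitian (x * a)"

definition MP_invertible :: "'a::complex_banach_monoid_algebra \<Rightarrow> bool"
  where "MP_invertible a \<longleftrightarrow> (\<exists>x. is_MP_inverse a x)"

definition MP_inverse :: "'a::complex_banach_monoid_algebra \<Rightarrow> 'a"
  where "MP_inverse a = (THE x. is_MP_inverse a x)"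

definition EP :: "'a::complex_banach_monoid_algebra \<Rightarrow> bool"
  where "EP a \<longleftrightarrow> MP_invertible a \<and> a * MP_inverse a = MP_inverse a * a"

end

theory Submission
  imports Defs
begin

text \<open>
  A projection is determined by its null space and its range, whence uniqueness. The other
  ingredient is that a hermitian projection is already determined by one of the two: for hermitian
  idempotents \<open>p\<close> and \<open>q\<close> with the same range, \<open>p q = q\<close> and \<open>q p = p\<close>, so \<open>p - q\<close> squares to zero
  and \<open>(1 - 2 p) (1 - 2 q) = 1 - 2 (p - q)\<close>. Both factors are values \<open>exp (i \<pi> h)\<close>, hence
  contractions, and the powers \<open>1 - 2 n (p - q)\<close> of the product can be bounded only if \<open>p = q\<close>.
  Multiplication by \<open>a a\<^sup>\<dagger>\<close> or \<open>a\<^sup>\<dagger> a\<close> gives hermitian projections on the algebra, which can thus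
  be compared with \<open>P\<close>. For an operator \<open>T\<close> with the null space and range of \<open>P\<close>, the operator
  \<open>T + 1 - P\<close> is bijective, and \<open>T\<^sup>\<dagger> = (T + 1 - P)\<^sup>-\<^sup>1 P\<close>.
\<close>

section \<open>The bounded inverse theorem\<close>

text \<open>By Baire, the closed image of some ball has an interior point. Differences of
  approximants move its centre to the origin, and scaling then reaches every \<open>z\<close>. The
  factor one half drives the iteration that follows.\<close>

lemma surj_bounded_linear_approx_preimage:
  fixes f :: "'a::real_normed_vector \<Rightarrow> 'b::banach"
  assumes f: "bounded_linear f" and surj: "surj f"
  obtains K where "\<And>z. \<exists>x. norm x \<le> K * norm z \<and> norm (z - f x) \<le> norm z / 2"
proof -
  interpret f: bounded_linear f by (rule f)
  let ?F = "\<lambda>n::nat. closure (f ` cball 0 (real n))"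
  have "\<exists>n. interior (?F n) \<noteq> {}"
  proof (rule ccontr)
    assume empty: "\<not> ?thesis"
    have "euclidean interior_of \<Union>(range ?F) = {}"
      by (rule Baire_category_alt) (use empty in \<open>auto simp: completely_metrizable_space_euclidean\<close>)
    moreover have "\<Union>(range ?F) = UNIV"
    proof -
      have "z \<in> \<Union>(range ?F)" for z
      proof -
        obtain x where x: "z = f x" using surj by blast
        obtain n :: nat where "norm x \<le> real n" using real_arch_simple by blast
        then have "z \<in> f ` cball 0 (real n)" using x by simp
        then have "z \<in> ?F n" by (rule subsetD[OF closure_subset])
        then show ?thesis by blast
      qed
      then show ?thesis by blast
    qed
    ultimately show False by simp
  qed
  then obtain n y where "y \<in> interior (?F n)" by blast
  then obtain r where r: "r > 0" and ball: "ball y r \<subseteq> ?F n"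
    by (meson mem_interior)
  \<comment> \<open>Approximating both \<open>y\<close> and \<open>y + z\<close> and subtracting
    removes \<open>y\<close>; this doubles the bound on the preimage and adds the two errors
    \<open>r / 8\<close>.\<close>
  have near: "\<exists>x. norm x \<le> 2 * real n \<and> norm (z - f x) < r / 4" if z: "norm z < r" for z
  proof -
    have approx: "\<exists>u. norm u \<le> real n \<and> norm (f u - w) < r / 8" if "w \<in> ball y r" for w
    proof -
      have "w \<in> ?F n" using ball that by blast
      then have *: "\<forall>e>0. \<exists>w'\<in>f ` cball 0 (real n). dist w' w < e"
        by (simp only: closure_approachable)
      show ?thesis using *[rule_format, of "r / 8"] r by (auto simp: dist_norm)
    qed
    obtain u where u: "norm u \<le> real n" "norm (f u - y) < r / 8"
      using approx[of y] r by auto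
    obtain v where v: "norm v \<le> real n" "norm (f v - (y + z)) < r / 8"
      using approx[of "y + z"] z by (auto simp: dist_norm)
    have "z - f (v - u) = (f u - y) - (f v - (y + z))" by (simp add: f.diff)
    then have "norm (z - f (v - u)) \<le> norm (f u - y) + norm (f v - (y + z))"
      by (simp only: norm_triangle_ineq4)
    then have "norm (z - f (v - u)) < r / 4" using u v by linarith
    moreover have "norm (v - u) \<le> 2 * real n"
      using norm_triangle_ineq4[of v u] u v by simp
    ultimately show ?thesis by blast
  qed
  show thesis
  proof (rule that[of "4 * real n / r"])
    fix z
    show "\<exists>x. norm x \<le> 4 * real n / r * norm z \<and> norm (z - f x) \<le> norm z / 2"
    proof (cases "z = 0")
      case True
      then show ?thesis by (intro exI[of _ 0]) (simp add: f.zero)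
    next
      case False
      \<comment> \<open>Scaling \<open>z\<close> to norm \<open>r / 2\<close> makes the error
        \<open>r / 4\<close> exactly half of the norm.\<close>
      define s where "s = r / (2 * norm z)"
      have s: "s > 0" using r False by (simp add: s_def)
      have sz: "s * norm z = r / 2" using False by (simp add: s_def)
      have "norm (s *\<^sub>R z) < r" using s sz r by simp
      from near[OF this] obtain x where x: "norm x \<le> 2 * real n" "norm (s *\<^sub>R z - f x) < r / 4"
        by blast
      have "z - f (inverse s *\<^sub>R x) = inverse s *\<^sub>R (s *\<^sub>R z - f x)"
        using s by (simp add: f.scaleR scaleR_diff_right)
      then have "norm (z - f (inverse s *\<^sub>R x)) = inverse s * norm (s *\<^sub>R z - f x)"
        using s by simp
      also have "\<dots> \<le> inverse s * (r / 4)"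
        using x s by (intro mult_left_mono) auto
      also have "\<dots> = norm z / 2" using r by (simp add: s_def)
      finally have 1: "norm (z - f (inverse s *\<^sub>R x)) \<le> norm z / 2" .
      have "norm (inverse s *\<^sub>R x) = inverse s * norm x" using s by simp
      also have "\<dots> \<le> inverse s * (2 * real n)"
        using x s by (intro mult_left_mono) auto
      also have "\<dots> = 4 * real n / r * norm z" by (simp add: s_def)
      finally show ?thesis using 1 by blast
    qed
  qed
qed

text \<open>Successive approximation: each residual is corrected by an approximate preimage, and
  completeness of the domain lets the corrections be summed.\<close>

theorem surj_bounded_linear_bounded_preimage:
  fixes f :: "'a::banach \<Rightarrow> 'b::banach"
  assumes f: "bounded_linear f" and surj: "surj f"
  obtains K where "\<And>z. \<exists>x. f x = z \<and> norm x \<le> K * norm z"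
proof -
  interpret f: bounded_linear f by (rule f)
  from surj_bounded_linear_approx_preimage[OF f surj] obtain K
    where "\<And>z. \<exists>x. norm x \<le> K * norm z \<and> norm (z - f x) \<le> norm z / 2" by blast
  then obtain g where g: "\<And>z. norm (g z) \<le> K * norm z" "\<And>z. norm (z - f (g z)) \<le> norm z / 2"
    by metis
  show thesis
  \<comment> \<open>The factor 2 is the sum of the geometric series; the absolute value covers a
    negative \<open>K\<close>.\<close>
  proof (rule that[of "2 * \<bar>K\<bar>"])
    fix z
    \<comment> \<open>\<open>w k\<close> is the residual left after \<open>k\<close>
      corrections.\<close>
    define w where "w k = ((\<lambda>w. w - f (g w)) ^^ k) z" for k
    have w_0: "w 0 = z" and w_Suc: "w (Suc k) = w k - f (g (w k))" for k
      by (simp_all add: w_def)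
    have norm_w: "norm (w k) \<le> norm z * (1/2) ^ k" for k
    proof (induction k)
      case (Suc k)
      then show ?case using g(2)[of "w k"] by (simp add: w_Suc)
    qed (simp add: w_0)
    have norm_gw: "norm (g (w k)) \<le> \<bar>K\<bar> * norm z * (1/2) ^ k" for k
    proof -
      have "norm (g (w k)) \<le> \<bar>K\<bar> * norm (w k)"
        using g(1)[of "w k"] mult_right_mono[OF abs_ge_self[of K] norm_ge_zero[of "w k"]] by linarith
      also have "\<dots> \<le> \<bar>K\<bar> * (norm z * (1/2) ^ k)"
        by (intro mult_left_mono norm_w) auto
      finally show ?thesis by simp
    qed
    have geom: "(\<lambda>k. \<bar>K\<bar> * norm z * (1/2) ^ k) sums (2 * \<bar>K\<bar> * norm z)"
      using sums_mult[OF geometric_sums[of "1/2::real"], of "\<bar>K\<bar> * norm z"]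
      by (simp add: mult_ac)
    have summ: "summable (\<lambda>k. norm (g (w k)))"
      by (rule summable_comparison_test'[OF sums_summable[OF geom], of 0]) (simp add: norm_gw)
    have "w \<longlonglongrightarrow> 0"
    proof (rule tendsto_0_le[where K = 1])
      show "(\<lambda>k. norm z * (1/2) ^ k) \<longlonglongrightarrow> 0"
        by (intro tendsto_mult_right_zero LIMSEQ_realpow_zero) auto
    qed (use norm_w in simp)
    \<comment> \<open>The images of the corrections are consecutive differences of residuals, so
      they telescope to \<open>z\<close>.\<close>
    then have "(\<lambda>k. w k - w (Suc k)) sums (w 0 - 0)"
      by (rule telescope_sums')
    then have "(\<lambda>k. f (g (w k))) sums z" by (simp add: w_0 w_Suc)
    moreover have "(\<lambda>k. f (g (w k))) sums f (\<Sum>k. g (w k))"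
      by (rule f.sums[OF summable_sums[OF summable_norm_cancel[OF summ]]])
    ultimately have "f (\<Sum>k. g (w k)) = z" using sums_unique2 by blast
    moreover have "norm (\<Sum>k. g (w k)) \<le> 2 * \<bar>K\<bar> * norm z"
      using summable_norm[OF summ] suminf_le[OF norm_gw summ sums_summable[OF geom]]
        sums_unique[OF geom] by simp
    ultimately show "\<exists>x. f x = z \<and> norm x \<le> 2 * \<bar>K\<bar> * norm z" by blast
  qed
qed

corollary bij_bounded_linear_inv:
  fixes f :: "'a::banach \<Rightarrow> 'b::banach"
  assumes f: "bounded_linear f" and bij: "bij f"
  shows "bounded_linear (inv f)"
proof -
  interpret f: bounded_linear f by (rule f)
  have inv_eq: "inv f z = x" if "f x = z" for x z
    using bij that by (auto simp: bij_def)
  have f_inv: "f (inv f z) = z" for z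
    using bij by (simp add: bij_def surj_f_inv_f)
  obtain K where K: "\<And>z. \<exists>x. f x = z \<and> norm x \<le> K * norm z"
    using surj_bounded_linear_bounded_preimage[OF f] bij by (auto simp: bij_def)
  show ?thesis
  proof (rule bounded_linear_intro)
    show "norm (inv f z) \<le> norm z * K" for z
      using K[of z] inv_eq by (metis mult.commute)
  qed (auto intro!: inv_eq simp: f.add f.scaleR f_inv)
qed

lemma bounded_linear_bop_apply: "bounded_linear (bop_apply T)"
  by transfer (rule blinfun.bounded_linear_right)

text \<open>Turns pointwise bijectivity into invertibility in the operator algebra, as required for
  \<open>T + 1 - P\<close>.\<close>

lemma bop_bij_inverse:
  fixes T :: "'a::complex_banach bop"
  assumes bij: "bij (bop_apply T)"
  obtains V where "V * T = 1" "T * V = 1"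
proof -
  let ?g = "inv (bop_apply T)"
  have bl: "bounded_linear ?g"
    by (rule bij_bounded_linear_inv[OF bounded_linear_bop_apply bij])
  have T_g: "bop_apply T (?g x) = x" and g_T: "?g (bop_apply T x) = x" for x
    using bij by (simp_all add: bij_def surj_f_inv_f)
  have "?g (c *\<^sub>C x) = c *\<^sub>C ?g x" for c x
    using g_T[of "c *\<^sub>C ?g x"] by (simp add: bop_apply_linear T_g)
  then have "blinfun_of_bop (bop_of_blinfun (Blinfun ?g)) = Blinfun ?g"
    by (intro bop_of_blinfun_inverse) (simp add: bounded_linear_Blinfun_apply[OF bl])
  then have "bop_apply (bop_of_blinfun (Blinfun ?g)) = ?g"
    by (metis bop_apply.rep_eq bounded_linear_Blinfun_apply[OF bl])
  then show thesis
    by (intro that[of "bop_of_blinfun (Blinfun ?g)"] bop_eqI)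
      (simp_all add: bop_apply_simps T_g g_T)
qed


section \<open>Hermitian idempotents\<close>

lemma scaleC_one: "1 *\<^sub>C (x::'a::complex_vector) = x"
  using scaleC_of_real[of 1 x] by simp

lemma scaleC_diff_left: "(c - d) *\<^sub>C (x::'a::complex_vector) = c *\<^sub>C x - d *\<^sub>C x"
  using scaleC_add_left[of "c - d" d x] by simp

lemma scaleC_scaleR_left: "(r *\<^sub>R c) *\<^sub>C (x::'a::complex_vector) = r *\<^sub>R c *\<^sub>C x"
  by (simp add: scaleR_conv_of_real scaleC_of_real flip: scaleC_scaleC)

lemma bounded_linear_scaleC_left:
  "bounded_linear (\<lambda>c. c *\<^sub>C (x::'a::complex_normed_vector))"
  by (rule bounded_linear_intro[where K = "norm x"])
    (auto simp: scaleC_add_left scaleC_scaleR_left norm_scaleC)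

text \<open>Exponents start at one: the zeroth power is \<open>1\<close>, which may differ from
  \<open>p\<close>.\<close>

lemma scaleC_idempotent_power:
  fixes p :: "'a::complex_banach_monoid_algebra"
  assumes "p * p = p"
  shows "(c *\<^sub>C p) ^ Suc n = c ^ Suc n *\<^sub>C p"
proof (induction n)
  case (Suc n)
  then show ?case
    using assms by (simp add: mult_scaleC_left mult_scaleC_right scaleC_scaleC mult_ac)
qed simp

lemma alg_exp_scaleC_idempotent:
  fixes p :: "'a::complex_banach_monoid_algebra"
  assumes p: "p * p = p"
  shows "alg_exp (c *\<^sub>C p) = 1 + (exp c - 1) *\<^sub>C p"
proof -
  have "(\<lambda>n. (c ^ n /\<^sub>R fact n) *\<^sub>C p) sums (exp c *\<^sub>C p)"
    by (rule bounded_linear.sums[OF bounded_linear_scaleC_left exp_converges])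
  \<comment> \<open>The scalar series contributes \<open>p\<close> at index 0 where the exponential
    has \<open>1\<close>; the single term \<open>1 - p\<close> corrects this.\<close>
  from sums_add[OF this sums_single[of 0 "\<lambda>_. 1 - p"]]
  have "(\<lambda>n. (c ^ n /\<^sub>R fact n) *\<^sub>C p + (if n = 0 then 1 - p else 0)) sums (exp c *\<^sub>C p + (1 - p))" .
  moreover have "(c ^ n /\<^sub>R fact n) *\<^sub>C p + (if n = 0 then 1 - p else 0) = (c *\<^sub>C p) ^ n /\<^sub>R fact n" for n
  proof (cases n)
    case (Suc m)
    then show ?thesis
      by (simp add: scaleC_idempotent_power[OF p] scaleC_scaleR_left del: power_Suc)
  qed (simp add: scaleC_one)
  ultimately have "(\<lambda>n. (c *\<^sub>C p) ^ n /\<^sub>R fact n) sums (exp c *\<^sub>C p + (1 - p))" by simp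
  then show ?thesis
    by (simp add: alg_exp_def sums_unique[symmetric] scaleC_diff_left scaleC_one)
qed

text \<open>Only norms of combinations of \<open>1\<close> and \<open>p\<close> remain, so
  hermiticity can be transported along linear isometries that preserve the unit.\<close>

lemma hermitian_idempotent_iff:
  fixes p :: "'a::complex_banach_monoid_algebra"
  assumes "p * p = p"
  shows "hermitian p \<longleftrightarrow> (\<forall>t::real. norm (1 + (exp (\<i> * complex_of_real t) - 1) *\<^sub>C p) = 1)"
  by (simp add: hermitian_def alg_exp_scaleC_idempotent[OF assms])

lemma hermitian_idempotent_reflection:
  fixes p :: "'a::complex_banach_monoid_algebra"
  assumes "p * p = p" "hermitian p"
  shows "norm (1 - 2 *\<^sub>R p) = 1"
proof -
  \<comment> \<open>The reflection is the exponential at \<open>t = pi\<close>, since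
    \<open>exp (\<i> * pi) = -1\<close>.\<close>
  have "(exp (\<i> * complex_of_real pi) - 1) *\<^sub>C p = - (2 *\<^sub>R p)"
    using scaleC_of_real[of "-2" p] by (simp add: mult.commute[of \<i>])
  then show ?thesis
    using assms hermitian_idempotent_iff[OF assms(1)] by (metis diff_conv_add_uminus)
qed

text \<open>The binomial expansion stops after the linear term, so the powers of
  \<open>1 + h\<close> grow linearly unless \<open>h\<close> vanishes.\<close>

lemma square_zero_contraction:
  fixes h :: "'a::{real_normed_algebra,monoid_mult}"
  assumes h: "h * h = 0" and le: "norm (1 + h) \<le> 1"
  shows "h = 0"
proof (rule ccontr)
  assume "h \<noteq> 0"
  have power: "(1 + h) ^ n = 1 + real n *\<^sub>R h" for n
    by (induction n) (simp_all add: algebra_simps h)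
  \<comment> \<open>The bound starts at exponent one because \<open>norm 1\<close> may exceed 1 in
    this class.\<close>
  have norm_power: "norm ((1 + h) ^ Suc n) \<le> 1" for n
  proof (induction n)
    case (Suc n)
    have "norm ((1 + h) ^ Suc (Suc n)) \<le> norm (1 + h) * norm ((1 + h) ^ Suc n)"
      by (metis norm_mult_ineq power_Suc)
    also have "\<dots> \<le> 1 * 1" by (intro mult_mono le Suc) auto
    finally show ?case by simp
  qed (simp add: le)
  obtain n where n: "1 + norm (1::'a) < real n * norm h"
    using \<open>h \<noteq> 0\<close> reals_Archimedean3[of "norm h"] by auto
  have "real (Suc n) * norm h = norm ((1 + h) ^ Suc n - 1)"
    by (simp add: power del: power_Suc)
  also have "\<dots> \<le> 1 + norm (1::'a)"
    using norm_triangle_ineq4[of "(1 + h) ^ Suc n" 1] norm_power[of n] by linarith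
  also have "\<dots> < real (Suc n) * norm h"
    using n by (simp add: algebra_simps add_strict_increasing2)
  finally show False by simp
qed

text \<open>For idempotent operators, the first alternative encodes equal ranges and the second
  equal null spaces.\<close>

lemma hermitian_idempotent_eqI:
  fixes p q :: "'a::complex_banach_monoid_algebra"
  assumes p: "p * p = p" "hermitian p" and q: "q * q = q" "hermitian q"
    and pq: "p * q = q \<and> q * p = p \<or> p * q = p \<and> q * p = q"
  shows "p = q"
proof -
  have sq: "(p - q) * (p - q) = 0"
    using p q pq by (auto simp: algebra_simps)
  have "norm ((1 - 2 *\<^sub>R p) * (1 - 2 *\<^sub>R q)) \<le> 1"
    using norm_mult_ineq[of "1 - 2 *\<^sub>R p" "1 - 2 *\<^sub>R q"]
    by (simp add: hermitian_idempotent_reflection p q)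
  moreover have "(1 - 2 *\<^sub>R p) * (1 - 2 *\<^sub>R q) = 1 - 2 *\<^sub>R p - 2 *\<^sub>R q + 4 *\<^sub>R (p * q)"
    by (simp add: algebra_simps)
  moreover have "4 *\<^sub>R x = 2 *\<^sub>R x + 2 *\<^sub>R x" for x :: 'a
    by (simp flip: scaleR_add_left)
  \<comment> \<open>The product of reflections is \<open>1 + 2 *\<^sub>R (q - p)\<close> if
    \<open>p * q = q\<close>, and \<open>1 + 2 *\<^sub>R (p - q)\<close> if
    \<open>p * q = p\<close>.\<close>
  ultimately have "norm (1 + 2 *\<^sub>R (q - p)) \<le> 1 \<or> norm (1 + 2 *\<^sub>R (p - q)) \<le> 1"
    using pq by (auto simp: algebra_simps)
  moreover have "(q - p) * (q - p) = 0"
    using sq by (simp add: algebra_simps)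
  with sq have "(2 *\<^sub>R (q - p)) * (2 *\<^sub>R (q - p)) = 0" "(2 *\<^sub>R (p - q)) * (2 *\<^sub>R (p - q)) = 0"
    by (simp_all only: mult_scaleR_left mult_scaleR_right scaleR_zero_right)
  ultimately have "2 *\<^sub>R (q - p) = 0 \<or> 2 *\<^sub>R (p - q) = 0"
    using square_zero_contraction by blast
  then show ?thesis by auto
qed

section \<open>Moore-Penrose inverses and their uniqueness\<close>

lemma is_MP_inverseD:
  assumes "is_MP_inverse a x"
  shows "a * x * a = a" "x * a * x = x" "a * (x * a) = a" "x * (a * x) = x"
    "hermitian (a * x)" "hermitian (x * a)"
  using assms by (simp_all add: is_MP_inverse_def flip: mult.assoc)

lemma is_MP_inverse_idempotent:
  assumes "is_MP_inverse a x"
  shows "a * x * (a * x) = a * x" "x * a * (x * a) = x * a"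
  by (simp_all add: mult.assoc is_MP_inverseD[OF assms])

text \<open>\<open>a * x\<close> and \<open>a * y\<close> satisfy the equal-range alternative,
  \<open>x * a\<close> and \<open>y * a\<close> the equal-null-space one, so they agree
  pairwise.\<close>

lemma is_MP_inverse_unique:
  fixes a :: "'a::complex_banach_monoid_algebra"
  assumes x: "is_MP_inverse a x" and y: "is_MP_inverse a y"
  shows "x = y"
proof -
  note D = is_MP_inverseD[OF x] is_MP_inverseD[OF y]
  have "a * x = a * y"
  proof (rule hermitian_idempotent_eqI)
    have "a * x * (a * y) = a * y" "a * y * (a * x) = a * x"
      using D by (simp_all flip: mult.assoc)
    then show "a * x * (a * y) = a * y \<and> a * y * (a * x) = a * x \<or>
      a * x * (a * y) = a * x \<and> a * y * (a * x) = a * y" by blast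
  qed (use x y in \<open>simp_all add: is_MP_inverse_idempotent is_MP_inverseD\<close>)
  moreover have "x * a = y * a"
  proof (rule hermitian_idempotent_eqI)
    have "x * a * (y * a) = x * a" "y * a * (x * a) = y * a"
      using D by (simp_all add: mult.assoc)
    then show "x * a * (y * a) = y * a \<and> y * a * (x * a) = x * a \<or>
      x * a * (y * a) = x * a \<and> y * a * (x * a) = y * a" by blast
  qed (use x y in \<open>simp_all add: is_MP_inverse_idempotent is_MP_inverseD\<close>)
  \<comment> \<open>The chain is \<open>x = x * a * x = x * a * y = y * a * y = y\<close>.\<close>
  ultimately have "x * (a * x) = y * a * y" by (simp flip: mult.assoc)
  then show ?thesis using D by simp
qed

lemma MP_inverse_eqI: "is_MP_inverse a x \<Longrightarrow> MP_inverse a = x"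
  unfolding MP_inverse_def by (rule the_equality) (auto intro: is_MP_inverse_unique)

text \<open>Uniqueness replaces the definite description by an existential witness.\<close>

lemma EP_iff: "EP a \<longleftrightarrow> (\<exists>x. is_MP_inverse a x \<and> a * x = x * a)"
  unfolding EP_def MP_invertible_def using MP_inverse_eqI by metis


section \<open>Hermitian projections\<close>

lemma idempotent_fixes_range:
  assumes "P * P = P" and "x \<in> op_range P"
  shows "bop_apply P x = x"
  using assms by (auto simp: op_range_def simp flip: bop_apply_simps(6))

lemma idempotent_diff_in_null_space:
  assumes "P * P = P"
  shows "x - bop_apply P x \<in> null_space P"
proof -
  have "bop_apply P (bop_apply P x) = bop_apply P x"
    using assms by (simp flip: bop_apply_simps(6))
  then show ?thesis by (simp add: null_space_def bop_apply_linear)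
qed

lemma idempotent_mult_range:
  assumes "P * P = P" and "op_range Q \<subseteq> op_range P"
  shows "P * Q = Q"
proof (rule bop_eqI)
  fix x
  have "bop_apply Q x \<in> op_range P" using assms(2) by (auto simp: op_range_def)
  with assms(1) show "bop_apply (P * Q) x = bop_apply Q x"
    by (simp add: bop_apply_simps(6) idempotent_fixes_range)
qed

text \<open>\<open>Q\<close> annihilates \<open>x - P x\<close>, which lies in the null space of
  \<open>P\<close>.\<close>

lemma idempotent_mult_null_space:
  assumes "P * P = P" and "null_space P \<subseteq> null_space Q"
  shows "Q * P = Q"
proof (rule bop_eqI)
  fix x
  have "bop_apply Q (x - bop_apply P x) = 0"
    using idempotent_diff_in_null_space[OF assms(1), of x] assms(2) by (auto simp: null_space_def)
  then show "bop_apply (Q * P) x = bop_apply Q x"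
    by (simp add: bop_apply_simps bop_apply_linear)
qed

text \<open>Evaluates \<open>P * Q\<close> twice: the ranges give \<open>Q\<close>, the null spaces
  give \<open>P\<close>.\<close>

lemma idempotent_eqI:
  assumes "P * P = P" "Q * Q = Q" "null_space P = null_space Q" "op_range P = op_range Q"
  shows "P = Q"
  using idempotent_mult_range[of P Q] idempotent_mult_null_space[of Q P] assms by simp

text \<open>Stated for arbitrary \<open>N\<close> and \<open>R\<close> so as to cover the operator
  case and both multiplication cases.\<close>

lemma hermitian_projections_le_one:
  "\<exists>\<^sub>\<le>\<^sub>1P. P \<in> hermitian_projections \<and> null_space P = N \<and> op_range P = R"
  by (auto intro!: Uniq_I idempotent_eqI simp: hermitian_projections_def)

lemma hermitian_projection_eqI_range:
  assumes P: "P \<in> hermitian_projections" and Q: "Q \<in> hermitian_projections"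
    and "op_range P = op_range Q"
  shows "P = Q"
proof (rule hermitian_idempotent_eqI)
  show "P * Q = Q \<and> Q * P = P \<or> P * Q = P \<and> Q * P = Q"
    using assms by (simp add: hermitian_projections_def idempotent_mult_range)
qed (use P Q in \<open>simp_all add: hermitian_projections_def\<close>)

lemma hermitian_projection_eqI_null_space:
  assumes P: "P \<in> hermitian_projections" and Q: "Q \<in> hermitian_projections"
    and "null_space P = null_space Q"
  shows "P = Q"
proof (rule hermitian_idempotent_eqI)
  show "P * Q = Q \<and> Q * P = P \<or> P * Q = P \<and> Q * P = Q"
    using assms by (simp add: hermitian_projections_def idempotent_mult_null_space)
qed (use P Q in \<open>simp_all add: hermitian_projections_def\<close>)

section \<open>EP operators\<close>

text \<open>The projection is \<open>T * S\<close>: it has the range of \<open>T\<close>, and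
  commutation identifies it with \<open>S * T\<close>, which has the null space of
  \<open>T\<close>.\<close>

lemma EP_imp_hermitian_projection:
  fixes T :: "'a::complex_banach bop"
  assumes "EP T"
  shows "\<exists>P\<in>hermitian_projections. null_space P = null_space T \<and> op_range P = op_range T"
proof -
  obtain S where MP: "is_MP_inverse T S" and comm: "T * S = S * T"
    using assms by (auto simp: EP_iff)
  note S = is_MP_inverseD(1,5)[OF MP] comm
  have idem: "T * S * (T * S) = T * S" by (rule is_MP_inverse_idempotent(1)[OF MP])
  have T: "bop_apply T (bop_apply S (bop_apply T x)) = bop_apply T x" for x
    using S(1) by (metis bop_apply_simps(6))
  have comm': "bop_apply T (bop_apply S x) = bop_apply S (bop_apply T x)" for x
    using S(3) by (metis bop_apply_simps(6))
  have "null_space (T * S) = null_space T"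
    by (auto simp: null_space_def bop_apply_simps comm' bop_apply_linear) (metis T bop_apply_linear(1))
  moreover have "op_range (T * S) = op_range T"
    by (auto simp: op_range_def bop_apply_simps image_def) (metis T)
  ultimately show ?thesis
    using idem S by (intro bexI[of _ "T * S"]) (auto simp: hermitian_projections_def)
qed

lemma hermitian_projection_imp_EP:
  fixes T :: "'a::complex_banach bop"
  assumes P: "P \<in> hermitian_projections"
    and N: "null_space P = null_space T" and R: "op_range P = op_range T"
  shows "EP T"
proof -
  have idem: "P * P = P" and herm: "hermitian P"
    using P by (auto simp: hermitian_projections_def)
  have PT: "P * T = T" using idem R by (simp add: idempotent_mult_range)
  have TP: "T * P = T" using idem N by (simp add: idempotent_mult_null_space)
  \<comment> \<open>\<open>U\<close> acts as \<open>T\<close> on the range of \<open>P\<close> and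
    as the identity on the null space of \<open>P\<close>.\<close>
  define U where "U = T + (1 - P)"
  have PU: "P * U = T" and UP: "U * P = T"
    by (simp_all add: U_def algebra_simps idem PT TP)
  have "bij (bop_apply U)"
  proof (rule bijI)
    show "inj (bop_apply U)"
    proof (rule injI)
      fix x y
      assume eq: "bop_apply U x = bop_apply U y"
      \<comment> \<open>Applying \<open>P\<close> to both sides recovers \<open>T\<close>, by
        \<open>P * U = T\<close>.\<close>
      have "bop_apply T x = bop_apply T y"
        using eq by (metis PU bop_apply_simps(6))
      then have "x - y \<in> null_space P"
        using N by (simp add: null_space_def bop_apply_linear)
      then have "bop_apply P x = bop_apply P y"
        by (simp add: null_space_def bop_apply_linear)
      then show "x = y"
        using eq \<open>bop_apply T x = bop_apply T y\<close> by (simp add: U_def bop_apply_simps)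
    qed
    show "surj (bop_apply U)"
    proof (rule surjI)
      fix y
      have "bop_apply P y \<in> range (bop_apply T)" using R by (auto simp: op_range_def)
      then have x: "bop_apply T (inv (bop_apply T) (bop_apply P y)) = bop_apply P y"
        by (rule f_inv_into_f)
      let ?x = "inv (bop_apply T) (bop_apply P y)"
      \<comment> \<open>\<open>y\<close> is split along \<open>P\<close>. The range part is lifted
        through \<open>T\<close> to \<open>?x\<close> and projected by \<open>P\<close>, where
        \<open>U\<close> acts as \<open>T\<close>; the other part is fixed by
        \<open>U\<close>.\<close>
      have "bop_apply U (bop_apply P ?x + (y - bop_apply P y)) =
          bop_apply (U * P) ?x + bop_apply (U * (1 - P)) y"
        by (simp add: bop_apply_simps bop_apply_linear)
      also have "U * (1 - P) = 1 - P" by (simp add: U_def algebra_simps idem TP)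
      finally show "bop_apply U (bop_apply P ?x + (y - bop_apply P y)) = y"
        by (simp add: UP x bop_apply_simps(2,4))
    qed
  qed
  then obtain V where VU: "V * U = 1" and UV: "U * V = 1" by (rule bop_bij_inverse)
  \<comment> \<open>Multiplying the inverse relations by \<open>P\<close> turns \<open>U\<close>
    into \<open>T\<close>.\<close>
  have TV: "T * V = P" using arg_cong[OF UV, of "(*) P"] by (simp add: PU flip: mult.assoc)
  have VT: "V * T = P" using arg_cong[OF VU, of "\<lambda>S. S * P"] by (simp add: UP mult.assoc)
  have TVP: "T * (V * P) = P" by (simp add: TV idem flip: mult.assoc)
  have VPT: "V * P * T = P" by (simp add: mult.assoc PT VT)
  \<comment> \<open>Both sides equal \<open>V * T * V\<close>.\<close>
  have comm: "P * V = V * P"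
    using arg_cong[OF TV, of "(*) V"] by (simp add: VT flip: mult.assoc)
  have "P * (V * P) = V * (P * P)"
    by (simp add: comm flip: mult.assoc)
  then have "is_MP_inverse T (V * P)"
    using herm by (simp add: is_MP_inverse_def TVP VPT PT idem)
  then show ?thesis using TVP VPT by (auto simp: EP_iff)
qed


section \<open>Multiplication operators\<close>

lift_definition lmult_bop :: "'a::complex_banach_algebra_1 \<Rightarrow> 'a bop" is blinfun_mult_right
  by (simp add: mult_scaleC_right)

lift_definition rmult_bop :: "'a::complex_banach_algebra_1 \<Rightarrow> 'a bop" is blinfun_mult_left
  by (simp add: mult_scaleC_left)

lemma bop_apply_lmult [simp]: "bop_apply (lmult_bop a) x = a * x"
  by transfer simp

lemma bop_apply_rmult [simp]: "bop_apply (rmult_bop a) x = x * a"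
  by transfer simp

text \<open>The lower bound comes from evaluation at the unit, which has norm 1.\<close>

lemma norm_lmult_bop: "norm (lmult_bop a) = norm a"
proof (rule antisym)
  show "norm (lmult_bop a) \<le> norm a"
    unfolding norm_bop_onorm by (rule onorm_le) (simp add: norm_mult_ineq)
  show "norm a \<le> norm (lmult_bop a)"
    using onorm[OF bounded_linear_bop_apply, of "lmult_bop a" 1] by (simp add: norm_bop_onorm)
qed

lemma norm_rmult_bop: "norm (rmult_bop a) = norm a"
proof (rule antisym)
  show "norm (rmult_bop a) \<le> norm a"
    unfolding norm_bop_onorm
    by (rule onorm_le) (simp add: norm_mult_ineq mult.commute[of "norm a"])
  show "norm a \<le> norm (rmult_bop a)"
    using onorm[OF bounded_linear_bop_apply, of "rmult_bop a" 1] by (simp add: norm_bop_onorm)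
qed

text \<open>Left multiplication is a linear isometry preserving the unit, so the norm criterion for
  idempotents carries over.\<close>

lemma lmult_bop_in_hermitian_projections:
  assumes p: "p * p = p" "hermitian p"
  shows "lmult_bop p \<in> hermitian_projections"
proof -
  have idem: "lmult_bop p * lmult_bop p = lmult_bop p"
    by (rule bop_eqI) (simp add: bop_apply_simps p flip: mult.assoc)
  have "1 + c *\<^sub>C lmult_bop p = lmult_bop (1 + c *\<^sub>C p)" for c
    by (rule bop_eqI) (simp add: bop_apply_simps distrib_right mult_scaleC_left)
  then have "hermitian (lmult_bop p)"
    using p by (simp add: hermitian_idempotent_iff idem norm_lmult_bop)
  with idem show ?thesis by (simp add: hermitian_projections_def)
qed

text \<open>Right multiplication reverses products, which is harmless for the square of a single
  element.\<close>

lemma rmult_bop_in_hermitian_projections: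
  assumes p: "p * p = p" "hermitian p"
  shows "rmult_bop p \<in> hermitian_projections"
proof -
  have idem: "rmult_bop p * rmult_bop p = rmult_bop p"
    by (rule bop_eqI) (simp add: bop_apply_simps p mult.assoc)
  have "1 + c *\<^sub>C rmult_bop p = rmult_bop (1 + c *\<^sub>C p)" for c
    by (rule bop_eqI) (simp add: bop_apply_simps distrib_left mult_scaleC_right)
  then have "hermitian (rmult_bop p)"
    using p by (simp add: hermitian_idempotent_iff idem norm_rmult_bop)
  with idem show ?thesis by (simp add: hermitian_projections_def)
qed

lemma lmult_bop_inject [simp]: "lmult_bop a = lmult_bop b \<longleftrightarrow> a = b"
  by (metis bop_apply_lmult mult_1_right)

lemma rmult_bop_inject [simp]: "rmult_bop a = rmult_bop b \<longleftrightarrow> a = b"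
  by (metis bop_apply_rmult mult_1_left)

section \<open>Multiplication by the two idempotents of a Moore-Penrose pair\<close>

locale MP_pair =
  fixes a x :: "'a::complex_banach_algebra_1"
  assumes MP: "is_MP_inverse a x"
begin

text \<open>The two bracketings match the normal forms arising for left and for right
  multiplication.\<close>

lemma axa: "a * (x * (a * y)) = a * y" "y * a * x * a = y * a"
  by (simp_all add: is_MP_inverseD[OF MP] mult.assoc) (simp add: is_MP_inverseD[OF MP] flip: mult.assoc)

lemma hermitian_projections:
  "lmult_bop (a * x) \<in> hermitian_projections" "lmult_bop (x * a) \<in> hermitian_projections"
  "rmult_bop (a * x) \<in> hermitian_projections" "rmult_bop (x * a) \<in> hermitian_projections"
  by (intro lmult_bop_in_hermitian_projections rmult_bop_in_hermitian_projections
      is_MP_inverse_idempotent[OF MP] is_MP_inverseD[OF MP])+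

lemma op_range_lmult: "op_range (lmult_bop (a * x)) = {a * y |y. True}"
  by (auto simp: op_range_def image_def mult.assoc) (metis axa(1))

lemma null_space_lmult: "null_space (lmult_bop (x * a)) = {y. a * y = 0}"
  by (auto simp: null_space_def mult.assoc) (metis axa(1) mult_zero_right)

text \<open>On the right the idempotents exchange roles: \<open>x * a\<close> determines the range
  and \<open>a * x\<close> the null space.\<close>

lemma op_range_rmult: "op_range (rmult_bop (x * a)) = {y * a |y. True}"
  by (auto simp: op_range_def image_def simp flip: mult.assoc) (metis axa(2))

lemma null_space_rmult: "null_space (rmult_bop (a * x)) = {y. y * a = 0}"
  by (auto simp: null_space_def simp flip: mult.assoc) (metis axa(2) mult_zero_left)

lemma EP_iff_commute: "EP a \<longleftrightarrow> a * x = x * a"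
  unfolding EP_iff using MP is_MP_inverse_unique[OF _ MP] by blast

lemma EP_iff_lmult_projection:
  "EP a \<longleftrightarrow> (\<exists>P\<in>hermitian_projections.
    null_space P = {y. a * y = 0} \<and> op_range P = {a * y |y. True})" (is "_ \<longleftrightarrow> ?R")
proof
  assume "EP a"
  then have "a * x = x * a" by (simp add: EP_iff_commute)
  then show ?R
    using hermitian_projections(1) op_range_lmult null_space_lmult
    by (intro bexI[of _ "lmult_bop (a * x)"]) simp_all
next
  assume ?R
  then obtain P where P: "P \<in> hermitian_projections"
    "null_space P = null_space (lmult_bop (x * a))" "op_range P = op_range (lmult_bop (a * x))"
    using op_range_lmult null_space_lmult by auto
  \<comment> \<open>The range alone forces the first equality and the null space alone the second;
    injectivity of \<open>lmult_bop\<close> then gives \<open>a * x = x * a\<close>.\<close>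
  have "P = lmult_bop (a * x)" "P = lmult_bop (x * a)"
    using P hermitian_projections
    by (auto intro: hermitian_projection_eqI_range hermitian_projection_eqI_null_space)
  then show "EP a" by (simp add: EP_iff_commute)
qed

lemma EP_iff_rmult_projection:
  "EP a \<longleftrightarrow> (\<exists>P\<in>hermitian_projections.
    null_space P = {y. y * a = 0} \<and> op_range P = {y * a |y. True})" (is "_ \<longleftrightarrow> ?R")
proof
  assume "EP a"
  then have "a * x = x * a" by (simp add: EP_iff_commute)
  then show ?R
    using hermitian_projections(3) op_range_rmult null_space_rmult
    by (intro bexI[of _ "rmult_bop (a * x)"]) simp_all
next
  assume ?R
  then obtain P where P: "P \<in> hermitian_projections"
    "null_space P = null_space (rmult_bop (a * x))" "op_range P = op_range (rmult_bop (x * a))"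
    using op_range_rmult null_space_rmult by auto
  \<comment> \<open>Again the range gives the first equality and the null space the second, now with
    the idempotents exchanged.\<close>
  have "P = rmult_bop (x * a)" "P = rmult_bop (a * x)"
    using P hermitian_projections
    by (auto intro: hermitian_projection_eqI_range hermitian_projection_eqI_null_space)
  then show "EP a" by (simp add: EP_iff_commute)
qed

end

theorem proposition13:
  fixes T :: "'x::complex_banach bop"
    and a :: "'a::complex_banach_algebra_1"
  shows "((EP T \<longleftrightarrow>
            (\<exists>P \<in> hermitian_projections. null_space P = null_space T \<and> op_range P = op_range T)) \<and>
          (\<exists>\<^sub>\<le>\<^sub>1P. P \<in> hermitian_projections \<and>
            null_space P = null_space T \<and> op_range P = op_range T)) \<and>
         (regular a \<and> MP_invertible a \<longrightarrow>
          (EP a \<longleftrightarrow>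
            (\<exists>P \<in> (hermitian_projections :: 'a bop set).
              null_space P = {x. a * x = 0} \<and> op_range P = {a * x |x. True})) \<and>
          (EP a \<longleftrightarrow>
            (\<exists>P \<in> (hermitian_projections :: 'a bop set).
              null_space P = {x. x * a = 0} \<and> op_range P = {x * a |x. True})) \<and>
          (\<exists>\<^sub>\<le>\<^sub>1P :: 'a bop. P \<in> hermitian_projections \<and>
              null_space P = {x. a * x = 0} \<and> op_range P = {a * x |x. True}) \<and>
          (\<exists>\<^sub>\<le>\<^sub>1P :: 'a bop. P \<in> hermitian_projections \<and>
              null_space P = {x. x * a = 0} \<and> op_range P = {x * a |x. True}))"
\<comment> \<open>The three uniqueness clauses are discharged here, leaving the three
  equivalences.\<close>
proof (intro conjI impI hermitian_projections_le_one)
  show "EP T \<longleftrightarrow>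
    (\<exists>P\<in>hermitian_projections. null_space P = null_space T \<and> op_range P = op_range T)"
    using EP_imp_hermitian_projection hermitian_projection_imp_EP by blast
  assume "regular a \<and> MP_invertible a"
  then obtain x where "is_MP_inverse a x" by (auto simp: MP_invertible_def)
  then interpret MP_pair a x by unfold_locales
  show "EP a \<longleftrightarrow> (\<exists>P\<in>hermitian_projections.
      null_space P = {y. a * y = 0} \<and> op_range P = {a * y |y. True})"
    by (rule EP_iff_lmult_projection)
  show "EP a \<longleftrightarrow> (\<exists>P\<in>hermitian_projections.
      null_space P = {y. y * a = 0} \<and> op_range P = {y * a |y. True})"
    by (rule EP_iff_rmult_projection)
qed

end
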